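(* Suppose that in Regime J the private signal has the linear information structure with parameter $q\in[0,1]$. For $(i,l)\in(0,1)^2$ let $q^\dagger=q^\dagger(i,l)\in(0,1)$ be the threshold such that, for $q\in[0,1]$, $U_J(q)>U_C$ if and only if $q>q^\dagger$, and let $q^\ddagger=q^\ddagger(i,l)\in(0,1)$ be the threshold such that, for $q\in[0,1]$, $AuditRisk_J(q)>AuditRisk_C$ if and only if $q<q^\ddagger$. Then both thresholds decrease in the verification incentive $i$ and increase in the audit incentive $l$: for all $(i,l)\in(0,1)^2$, $$\frac{\partial q^\dagger}{\partial i}<0,\qquad \frac{\partial q^\dagger}{\partial l}>0,\qquad \frac{\partial q^\ddagger}{\partial i}<0,\qquad \frac{\partial q^\ddagger}{\partial l}>0 .$$
   Context: A state $\theta\in\{G,B\}$ has $\Pr(\theta=G)=\Pr(\theta=B)=1/2$. Parameters: $c>I>0$, $k>L>0$, $X/2>I$; $i=I/c$ is the verification incentive and $l=L/k$ the audit incentive, so $i,l\in(0,1)$. An auditor with effort $\beta$ issues a report $r$ with $\Pr(r=g\mid G)=1$, $\Pr(r=g\mid B)=1-\beta$. After $r=g$ the stakeholder verifies at a level $a\in[0,1)$, at cost $\frac12ca^2$, which identifies the state with probability $a$. Linear information structure: the signal $s\in\{G,B,\emptyset\}$, independent of $r$ given $\theta$, equals $\theta$ with probability $q$ and equals $\emptyset$ (no information) with probability $1-q$, in each state $\theta$. Regime J (verification chosen after seeing $s$ and $r=g$; effort unobserved): in the unique equilibrium the verification levels are $a(G)=0$, $a(B)=i$, $a(\emptyset)=i\frac{1-\beta_J}{2-\beta_J}$;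 the critical verification level is $\bar a_J=qi+(1-q)i\frac{1-\beta_J}{2-\beta_J}$, and the effort $\beta_J=\beta_J(q)$ is the unique $\beta_J\in[0,1)$ with $\beta_J=\frac l2\bar a_J$. The stakeholder's equilibrium ex-ante expected payoff equals $$U_J(q)=\tfrac12(X-I)-\tfrac12(1-\beta_J)\Big(1-\tfrac{\bar a_J}{2}\Big)I,$$ and the audit risk (probability of an undetected audit failure) is $AuditRisk_J(q)=\frac12(1-\beta_J)(1-\bar a_J)$. Regime C (the stakeholder commits to $a$ before the auditor's effort, no signal; the auditor best-responds with $\beta=\frac l2a$): $a_C$ is the unique solution $a\in(0,1)$ of $3la^2-(8+4il)a+2i(l+2)=0$, $\beta_C=\frac l2a_C$, the stakeholder's equilibrium ex-ante expected payoff is $$U_C=\tfrac12(X-I)-\tfrac12(1-\beta_C)(1-a_C)I-\Big(\tfrac12+\tfrac12(1-\beta_C)\Big)\tfrac{c a_C^2}{2},$$ and $AuditRisk_C=\frac12(1-\beta_C)(1-a_C)$. Both thresholds exist, are uniquely determined, and depend on the parameters only through $(i,l)$. *)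

theory Defs
  imports "HOL-Analysis.Analysis"
begin

text \<open>Primitives: payoff parameters \<open>X\<close> and \<open>I\<close>, verification cost parameter \<open>c\<close>,
  audit parameters \<open>L\<close> and \<open>k\<close>. The incentives are \<open>i = I / c\<close> and
  \<open>l = L / k\<close>; \<open>q\<close> is the probability that the private signal reveals the state.\<close>

definition admissible :: "real \<Rightarrow> real \<Rightarrow> real \<Rightarrow> real \<Rightarrow> real \<Rightarrow> bool" where
  "admissible X I c L k \<longleftrightarrow> 0 < I \<and> I < c \<and> 0 < L \<and> L < k \<and> I < X / 2"

datatype signal = Sig_Good | Sig_Bad | Sig_None

fun verif_J :: "real \<Rightarrow> real \<Rightarrow> signal \<Rightarrow> real" where
  "verif_J i \<beta> Sig_Good = 0"
| "verif_J i \<beta> Sig_Bad = i"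
| "verif_J i \<beta> Sig_None = i * ((1 - \<beta>) / (2 - \<beta>))"

text \<open>The critical verification level is the expected level in the bad state, where the signal
  is \<open>Sig_Bad\<close> with probability \<open>q\<close> and \<open>Sig_None\<close> otherwise.\<close>

definition crit_verif :: "real \<Rightarrow> real \<Rightarrow> real \<Rightarrow> real" where
  "crit_verif i q \<beta> = q * verif_J i \<beta> Sig_Bad + (1 - q) * verif_J i \<beta> Sig_None"

definition beta_J :: "real \<Rightarrow> real \<Rightarrow> real \<Rightarrow> real" where
  "beta_J i l q = (THE \<beta>. 0 \<le> \<beta> \<and> \<beta> < 1 \<and> \<beta> = l / 2 * crit_verif i q \<beta>)"

definition a_bar_J :: "real \<Rightarrow> real \<Rightarrow> real \<Rightarrow> real" where
  "a_bar_J i l q = crit_verif i q (beta_J i l q)"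

definition U_J :: "real \<Rightarrow> real \<Rightarrow> real \<Rightarrow> real \<Rightarrow> real \<Rightarrow> real \<Rightarrow> real" where
  "U_J X I c L k q =
     1/2 * (X - I)
     - 1/2 * (1 - beta_J (I / c) (L / k) q) * (1 - a_bar_J (I / c) (L / k) q / 2) * I"

definition audit_risk_J :: "real \<Rightarrow> real \<Rightarrow> real \<Rightarrow> real \<Rightarrow> real \<Rightarrow> real" where
  "audit_risk_J I c L k q =
     1/2 * (1 - beta_J (I / c) (L / k) q) * (1 - a_bar_J (I / c) (L / k) q)"

definition a_C :: "real \<Rightarrow> real \<Rightarrow> real" where
  "a_C i l = (THE a. 0 < a \<and> a < 1 \<and> 3 * l * a\<^sup>2 - (8 + 4 * i * l) * a + 2 * i * (l + 2) = 0)"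

definition beta_C :: "real \<Rightarrow> real \<Rightarrow> real" where
  "beta_C i l = l / 2 * a_C i l"

definition U_C :: "real \<Rightarrow> real \<Rightarrow> real \<Rightarrow> real \<Rightarrow> real \<Rightarrow> real" where
  "U_C X I c L k =
     1/2 * (X - I)
     - 1/2 * (1 - beta_C (I / c) (L / k)) * (1 - a_C (I / c) (L / k)) * I
     - (1/2 + 1/2 * (1 - beta_C (I / c) (L / k))) * (c * (a_C (I / c) (L / k))\<^sup>2 / 2)"

definition audit_risk_C :: "real \<Rightarrow> real \<Rightarrow> real \<Rightarrow> real \<Rightarrow> real" where
  "audit_risk_C I c L k =
     1/2 * (1 - beta_C (I / c) (L / k)) * (1 - a_C (I / c) (L / k))"

text \<open>The thresholds depend on the primitives only through the two incentives, so a single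
  number has to serve every admissible choice of primitives with these incentives.\<close>

definition q_dagger :: "real \<Rightarrow> real \<Rightarrow> real" where
  "q_dagger i l = (THE t. 0 < t \<and> t < 1 \<and>
     (\<forall>X I c L k. admissible X I c L k \<and> I / c = i \<and> L / k = l \<longrightarrow>
        (\<forall>q\<in>{0..1}. U_J X I c L k q > U_C X I c L k \<longleftrightarrow> q > t)))"

definition q_ddagger :: "real \<Rightarrow> real \<Rightarrow> real" where
  "q_ddagger i l = (THE t. 0 < t \<and> t < 1 \<and>
     (\<forall>X I c L k. admissible X I c L k \<and> I / c = i \<and> L / k = l \<longrightarrow>
        (\<forall>q\<in>{0..1}. audit_risk_J I c L k q > audit_risk_C I c L k \<longleftrightarrow> q < t)))"

end

theory Submission
  imports Defs
begin

text \<open>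
  Put \<open>p = l / 2\<close> and measure payoffs by the loss relative to the first best, in units of \<open>I / 2\<close>.
  In Regime J a critical level \<open>x\<close> has loss \<open>(1 - p x) (1 - x / 2)\<close> and arises from exactly one
  signal precision \<open>x (2 - p x) / i - 1 + p x\<close>, which is increasing in \<open>x\<close>. Hence the second
  threshold is the precision at the commitment level \<open>a\<close>, and the first one is the precision at
  the level \<open>b\<close> whose loss equals the minimal loss of Regime C. At any level the two losses differ
  by half the level times the precision; since \<open>a\<close> minimises the loss of Regime C, both
  thresholds are positive and \<open>b < a\<close>.

  Both \<open>a\<close> and \<open>b\<close> are smaller roots of quadratics, hence differentiable in the parameters. With
  \<open>u = p a\<close> and \<open>b = a (1 - d)\<close>, the equations defining \<open>a\<close> and \<open>b\<close> make \<open>i\<close> and \<open>p\<close> rational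
  in \<open>a\<close>, \<open>u\<close>, \<open>d\<close>. The signs of the derivatives of the first threshold become inequalities
  between polynomials in \<open>u\<close> and \<open>d\<close> on \<open>0 < u < 3/10\<close>, \<open>0 < d < 1/4\<close>.
\<close>

subsection \<open>The smaller root of a quadratic\<close>

definition small_root :: "real \<Rightarrow> real \<Rightarrow> real \<Rightarrow> real" where
  "small_root A B C = (B - sqrt (B\<^sup>2 - 4 * A * C)) / (2 * A)"

text \<open>The condition \<open>2 * A * x < B\<close> puts x left of the vertex, so
  \<open>B - 2 * A * x\<close> is the positive root of the discriminant.\<close>

lemma small_root_unique:
  assumes "A > 0" "A * x\<^sup>2 - B * x + C = 0" "2 * A * x < B"
  shows "small_root A B C = x"
proof -
  have C: "C = B * x - A * x\<^sup>2"
    using assms(2) by simp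
  have "B\<^sup>2 - 4 * A * C = (B - 2 * A * x)\<^sup>2"
    unfolding C by (simp add: power2_eq_square algebra_simps)
  then have "sqrt (B\<^sup>2 - 4 * A * C) = B - 2 * A * x"
    using assms(3) by simp
  then show ?thesis
    using assms(1) by (simp add: small_root_def)
qed

text \<open>Completing the square: a point with negative value lies strictly between two real roots,
  so a single witness gives both conclusions.\<close>

lemma small_root_less:
  assumes "A > 0" "A * m\<^sup>2 - B * m + C < 0"
  shows "B\<^sup>2 - 4 * A * C > 0" "small_root A B C < m"
proof -
  have "(B - 2 * A * m)\<^sup>2 = B\<^sup>2 - 4 * A * C + 4 * A * (A * m\<^sup>2 - B * m + C)"
    by (simp add: power2_eq_square algebra_simps)
  moreover have "4 * A * (A * m\<^sup>2 - B * m + C) < 0"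
    using assms by (simp add: mult_pos_neg)
  ultimately have less: "(B - 2 * A * m)\<^sup>2 < B\<^sup>2 - 4 * A * C"
    by linarith
  then show "B\<^sup>2 - 4 * A * C > 0"
    by (meson le_less_trans zero_le_power2)
  have "B - 2 * A * m < sqrt (B\<^sup>2 - 4 * A * C)"
    using less by (simp add: real_less_rsqrt)
  then show "small_root A B C < m"
    using assms(1) by (simp add: small_root_def field_simps)
qed

lemma small_root_greater:
  assumes "A > 0" "A * z\<^sup>2 - B * z + C > 0" "2 * A * z < B"
  shows "z < small_root A B C"
proof -
  have "(B - 2 * A * z)\<^sup>2 = B\<^sup>2 - 4 * A * C + 4 * A * (A * z\<^sup>2 - B * z + C)"
    by (simp add: power2_eq_square algebra_simps)
  moreover have "4 * A * (A * z\<^sup>2 - B * z + C) > 0"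
    using assms by simp
  ultimately have "B\<^sup>2 - 4 * A * C < (B - 2 * A * z)\<^sup>2"
    by linarith
  \<comment> \<open>A negative discriminant is covered as well, since \<open>sqrt\<close> is
    odd.\<close>
  then have "sqrt (B\<^sup>2 - 4 * A * C) < B - 2 * A * z"
    using assms(3) by (simp add: real_less_lsqrt)
  then show ?thesis
    using assms(1) by (simp add: small_root_def field_simps)
qed

lemma small_root_slope:
  assumes "A > 0"
  shows "B - 2 * A * small_root A B C = sqrt (B\<^sup>2 - 4 * A * C)"
  using assms by (simp add: small_root_def field_simps)

lemma small_root_root:
  assumes "A > 0" "B\<^sup>2 - 4 * A * C > 0"
  shows "A * (small_root A B C)\<^sup>2 - B * small_root A B C + C = 0"
proof -
  let ?r = "small_root A B C"
  have "(B - 2 * A * ?r)\<^sup>2 = B\<^sup>2 - 4 * A * C"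
    using assms by (simp add: small_root_slope)
  then have "4 * A * (A * ?r\<^sup>2 - B * ?r + C) = 0"
    by (simp add: power2_eq_square algebra_simps)
  then show ?thesis
    using assms(1) by simp
qed

text \<open>Implicit differentiation of the root equation. Keeping r in the derivative frees the
  later sign arguments from square roots.\<close>

lemma has_real_derivative_small_root:
  assumes A: "(A has_real_derivative A') (at x)"
    and B: "(B has_real_derivative B') (at x)"
    and C: "(C has_real_derivative C') (at x)"
    and pos: "A x > 0" "(B x)\<^sup>2 - 4 * A x * C x > 0"
    and r: "r = small_root (A x) (B x) (C x)"
  shows "((\<lambda>x. small_root (A x) (B x) (C x)) has_real_derivative
           (A' * r\<^sup>2 - B' * r + C') / (B x - 2 * A x * r)) (at x)"
proof -
  define s where "s = sqrt ((B x)\<^sup>2 - 4 * A x * C x)"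
  have s: "s > 0" "s\<^sup>2 = (B x)\<^sup>2 - 4 * A x * C x"
    using pos by (simp_all add: s_def)
  have slope: "B x - 2 * A x * r = s"
    using pos small_root_slope r s_def by simp
  have root: "A x * r\<^sup>2 - B x * r + C x = 0"
    using pos small_root_root r by simp
  \<comment> \<open>With \<open>B x\<close> and \<open>C x\<close> written in s and r, the
    derivative of the explicit formula agrees with the implicit one as a rational identity.\<close>
  have Bx: "B x = s + 2 * A x * r"
    using slope by simp
  have Cx: "C x = s * r + A x * r\<^sup>2"
    using root unfolding Bx by (simp add: power2_eq_square algebra_simps)
  have "((\<lambda>x. small_root (A x) (B x) (C x)) has_real_derivative
      ((B' - (2 * B x * B' - (4 * A' * C x + 4 * A x * C')) / (2 * s)) * (2 * A x)
        - (B x - s) * (2 * A')) / (2 * A x)\<^sup>2) (at x)"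
    unfolding small_root_def
    using pos s(1) unfolding s_def
    by (auto intro!: derivative_eq_intros A B C simp: field_simps power2_eq_square)
  moreover have "((B' - (2 * B x * B' - (4 * A' * C x + 4 * A x * C')) / (2 * s)) * (2 * A x)
        - (B x - s) * (2 * A')) / (2 * A x)\<^sup>2 = (A' * r\<^sup>2 - B' * r + C') / s"
    unfolding Bx Cx using s(1) pos(1) by (simp add: field_simps power2_eq_square)
  ultimately show ?thesis
    unfolding slope by simp
qed

subsection \<open>Two polynomial inequalities\<close>

text \<open>These linear relations between consecutive powers let \<open>linarith\<close> prove
  one-variable polynomial inequalities on \<open>0 < u < c\<close>.\<close>

lemma power_bounds:
  fixes u c :: real
  assumes "0 < u" "u < c"
  shows "0 \<le> u^2" "0 \<le> u^3" "0 \<le> u^4" "0 \<le> u^5" "0 \<le> u^6"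
    "u^2 \<le> c * u" "u^3 \<le> c * u^2" "u^4 \<le> c * u^3" "u^5 \<le> c * u^4" "u^6 \<le> c * u^5"
proof -
  have "u ^ Suc n \<le> c * u ^ n" for n
    using assms by (auto intro: mult_right_mono)
  from this[of 1] this[of 2] this[of 3] this[of 4] this[of 5]
  show "u^2 \<le> c * u" "u^3 \<le> c * u^2" "u^4 \<le> c * u^3" "u^5 \<le> c * u^4" "u^6 \<le> c * u^5"
    by (simp_all add: power2_eq_square)
qed (use assms in auto)

text \<open>The hypothesis on \<open>p\<close> below is the equation relating \<open>p\<close>, \<open>u = p a\<close> and \<open>d = 1 - b / a\<close>.
  Clearing \<open>p\<close> with it makes a factor \<open>d\<close> visible.\<close>

lemma verification_polynomial_pos:
  fixes u d p :: real
  assumes "0 < u" "u < 3/10" "0 < d" "d < 1/4"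
    and p: "p * (4 - 2 * u - 8 * d + 6 * u * d) = d * (1 - 2 * u + u * d) * (4 - 3 * u) + u * (3 - u)"
  shows "(4 - 3 * u) * (2 * p + 1 - 2 * (u * (1 - d))) * (1 - d) * (2 - u * (1 - d))
       - (2 - u) * (4 * (1 - u * (1 - d)) * (1 + p - 2 * u) + u * (4 - 3 * u)) > 0" (is "?E > 0")
proof -
  let ?D = "4 - 2 * u - 8 * d + 6 * u * d"
  let ?P = "24 - 34*u + 16*u^2 - 3*u^3 - (72 - 134*u + 84*u^2 - 18*u^3) * d
      + (32 - 112*u + 106*u^2 - 30*u^3) * d^2 + u * (4 - 3 * u)^2 * d^3"
  have D: "?D > 0"
    using assms(1-4) mult_pos_pos[of u d] by linarith
  \<comment> \<open>\<open>?E\<close> is affine in p, so one factor \<open>?D\<close> eliminates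
    p.\<close>
  have "?E * ?D = 2 * u * d * ?P"
    using p by algebra
  moreover have "?P > 0"
  proof -
    note bounds = power_bounds[OF assms(1,2)]
    \<comment> \<open>The subtracted coefficient is nonnegative, so \<open>d = 1/4\<close> is the
      worst case of the linear term.\<close>
    have "(72 - 134*u + 84*u^2 - 18*u^3) * d \<le> (72 - 134*u + 84*u^2 - 18*u^3) * (1/4)"
    proof (rule mult_left_mono)
      show "0 \<le> 72 - 134*u + 84*u^2 - 18*u^3"
        using bounds assms(1-4) by linarith
    qed (use assms in simp)
    moreover have "24 - 34*u + 16*u^2 - 3*u^3 - (72 - 134*u + 84*u^2 - 18*u^3) * (1/4) =
        6 - u/2 - 5*u^2 + 3/2*u^3"
      by (simp add: field_simps)
    moreover have "6 - u/2 - 5*u^2 + 3/2*u^3 > 0"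
      using bounds assms(1-4) by linarith
    moreover have "(32 - 112*u + 106*u^2 - 30*u^3) * d^2 \<ge> 0"
    proof (intro mult_nonneg_nonneg zero_le_power2)
      \<comment> \<open>Near \<open>u = 3/10\<close> the part \<open>32 - 112*u\<close> is negative;
        the tangent of \<open>u^2\<close> at 3/10 supplies the lower bound that compensates.\<close>
      have "0 \<le> (u - 3/10)^2"
        by simp
      then have "3/5 * u - 9/100 \<le> u^2"
        by (simp add: power2_eq_square algebra_simps)
      then show "32 - 112*u + 106*u^2 - 30*u^3 \<ge> 0"
        using bounds assms(1-4) by linarith
    qed
    moreover have "u * (4 - 3 * u)^2 * d^3 \<ge> 0"
      using assms(1-4) by simp
    ultimately show ?thesis
      by linarith
  qed
  ultimately have "?E * ?D > 0"
    using assms by simp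
  then show ?thesis
    using D by (simp only: zero_less_mult_iff) auto
qed

lemma audit_polynomial_pos:
  fixes u d p :: real
  assumes "0 < u" "u < 3/10" "0 < d" "d < 1/4"
    and p: "p * (4 - 2 * u - 8 * d + 6 * u * d) = d * (1 - 2 * u + u * d) * (4 - 3 * u) + u * (3 - u)"
  shows "2 * (4 * (1 - u * (1 - d)) * (1 + p - 2 * u) + u * (4 - 3 * u)) *
      ((4 - 3 * u) * (p * d - u + u * (1 - d)\<^sup>2 / 2) + u * (1 + p - 2 * u))
    + (4 - 3 * u) * u * (1 - d) * (4 - 3 * u - 2 * (1 - d) * (1 + p - 2 * u)) * (2 * p + 1 - 2 * (u * (1 - d))) > 0" (is "?F > 0")
proof -
  let ?D = "4 - 2 * u - 8 * d + 6 * u * d"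
  let ?Q = "8 * u^2 * (4 - 3 * u)^2
     + (512 - 1536*u + 1312*u^2 - 304*u^3 + 88*u^4 - 132*u^5 + 36*u^6) * d
     - (512 - 2048*u + 2336*u^2 - 848*u^3 + 104*u^4 - 156*u^5 + 72*u^6) * d^2
     + (384*u^2 - 512*u^3 + 248*u^4 - 156*u^5 + 72*u^6) * d^3
     + (256*u^2 - 576*u^3 + 560*u^4 - 300*u^5 + 72*u^6) * d^4
     + (256*u^3 - 576*u^4 + 432*u^5 - 108*u^6) * d^5"
  have D: "?D > 0"
    using assms(1-4) mult_pos_pos[of u d] by linarith
  \<comment> \<open>\<open>?F\<close> is quadratic in p, so eliminating p takes two factors
    \<open>?D\<close>.\<close>
  have "?F * ?D * ?D = d * ?Q"
    using p by algebra
  moreover have "?Q > 0"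
  proof -
    note bounds = power_bounds[OF assms(1,2)]
    let ?c = "512 - 1536*u + 1312*u^2 - 304*u^3 + 88*u^4 - 132*u^5 + 36*u^6"
    let ?c' = "512 - 2048*u + 2336*u^2 - 848*u^3 + 104*u^4 - 156*u^5 + 72*u^6"
    have c: "?c > 0"
      using bounds assms(1-4) by linarith
    \<comment> \<open>\<open>?c - ?c' * d\<close> is affine in d, hence a convex combination of its
      values at 0 and 1/4. This is the value at 1/4.\<close>
    have "384 - 1024*u + 728*u^2 - 92*u^3 + 62*u^4 - 93*u^5 + 18*u^6 > 0"
      using bounds assms(1-4) by linarith
    then have c': "?c - ?c' / 4 > 0"
      by (simp add: field_simps)
    have d: "1 - 4 * d > 0" "4 * d > 0"
      using assms(3,4) by simp_all
    have "(1 - 4 * d) * ?c + 4 * d * (?c - ?c' / 4) > 0"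
      by (rule add_pos_pos[OF mult_pos_pos[OF d(1) c] mult_pos_pos[OF d(2) c']])
    then have "?c - ?c' * d > 0"
      by (simp add: field_simps)
    then have "?c * d - ?c' * d^2 > 0"
      using assms(3) mult_pos_pos[of "?c - ?c' * d" d] by (simp add: power2_eq_square algebra_simps)
    moreover have "(384*u^2 - 512*u^3 + 248*u^4 - 156*u^5 + 72*u^6) * d^3 \<ge> 0"
      "(256*u^2 - 576*u^3 + 560*u^4 - 300*u^5 + 72*u^6) * d^4 \<ge> 0"
      "(256*u^3 - 576*u^4 + 432*u^5 - 108*u^6) * d^5 \<ge> 0"
      using bounds assms(1-4) by (intro mult_nonneg_nonneg; (linarith | simp))+
    moreover have "8 * u^2 * (4 - 3 * u)^2 \<ge> 0"
      by simp
    ultimately show ?thesis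
      by linarith
  qed
  ultimately have "?F * ?D * ?D > 0"
    using assms by simp
  then show ?thesis
    using D by (simp only: zero_less_mult_iff) auto
qed

subsection \<open>Losses, precision and the two critical levels\<close>

definition loss_J :: "real \<Rightarrow> real \<Rightarrow> real" where
  "loss_J p x = (1 - p * x) * (1 - x / 2)"

definition loss_C :: "real \<Rightarrow> real \<Rightarrow> real \<Rightarrow> real" where
  "loss_C i p x = (1 - p * x) * (1 - x) + (2 - p * x) * x\<^sup>2 / (2 * i)"

text \<open>The signal precision at which the level \<open>x\<close> is the equilibrium critical level of Regime J.\<close>

definition precision :: "real \<Rightarrow> real \<Rightarrow> real \<Rightarrow> real" where
  "precision i p x = x * (2 - p * x) / i - 1 + p * x"

text \<open>The quadratic is \<open>- 2 * i\<close> times the derivative of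
  \<open>loss_C i p\<close>, and half the quadratic of Regime C at \<open>l = 2 * p\<close>. At the
  smaller root the derivative turns from negative to positive.\<close>

definition opt :: "real \<Rightarrow> real \<Rightarrow> real" where
  "opt i p = small_root (3 * p) (4 + 4 * i * p) (2 * i * (1 + p))"

definition min_loss :: "real \<Rightarrow> real \<Rightarrow> real" where
  "min_loss i p = loss_C i p (opt i p)"

text \<open>The critical level at which Regime J has the same loss as Regime C.\<close>

definition match :: "real \<Rightarrow> real \<Rightarrow> real" where
  "match i p = small_root p (2 * p + 1) (2 * (1 - min_loss i p))"

lemma loss_C_eq: "i \<noteq> 0 \<Longrightarrow> loss_C i p x = loss_J p x + x * precision i p x / 2"
  by (simp add: loss_C_def loss_J_def precision_def field_simps power2_eq_square)

lemma precision_less: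
  assumes "0 < i" "0 < p" "p < 1/2" "0 \<le> x" "x < y" "y < 1"
  shows "precision i p x < precision i p y"
proof -
  have "p * (x + y) < 1/2 * 2"
    using assms by (intro mult_strict_mono) auto
  then have "0 < (y - x) * ((2 - p * (x + y)) / i + p)"
    using assms by (intro mult_pos_pos add_pos_pos divide_pos_pos) auto
  also have "\<dots> = precision i p y - precision i p x"
    using assms by (simp add: precision_def field_simps)
  finally show ?thesis by simp
qed

lemma loss_J_less:
  assumes "0 < p" "p < 1/2" "0 \<le> x" "x < y" "y < 1"
  shows "loss_J p y < loss_J p x"
proof -
  have "p * (x + y) < p * 2"
    using assms by (intro mult_strict_left_mono) auto
  then have "0 < p + 1/2 - p * (x + y) / 2"
    using assms by linarith
  then have "0 < (y - x) * (p + 1/2 - p * (x + y) / 2)"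
    using assms by (intro mult_pos_pos) auto
  also have "\<dots> = loss_J p x - loss_J p y"
    by (simp add: loss_J_def field_simps)
  finally show ?thesis by simp
qed

text \<open>The slopes below contain \<open>C / D\<close>, the response of a critical level, times
  the partial derivative of \<open>precision\<close> in that level. The exponent n leaves room for
  the powers of i in other denominators.\<close>

lemma clear_denominators:
  fixes D i :: real
  assumes "D \<noteq> 0" "i \<noteq> 0"
  shows "C / D * (y / i + p) * (i ^ Suc n * D) = C * i ^ n * (y + p * i)"
  using assms by (simp add: field_simps)

section \<open>Bounds on the commitment level and its precision\<close>

context
  fixes i p :: real
  assumes ip: "0 < i" "i < 1" "0 < p" "p < 1/2"
begin

text \<open>The value at 3/5 increases in i and is still negative at \<open>i = 1\<close>. At the
  corner \<open>i = 1\<close>, \<open>p = 1/2\<close> the root is 2 - sqrt 2, about 0.586, so 3/5 is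
  a tight round bound; it leads to \<open>u < 3/10\<close>.\<close>

lemma opt_quadratic_neg: "3 * p * (3/5)\<^sup>2 - (4 + 4 * i * p) * (3/5) + 2 * i * (1 + p) < 0"
proof -
  have "0 < (1 - i) * (2 - 2/5 * p) + (2/5 - 17/25 * p)"
    using ip by (intro add_pos_pos mult_pos_pos) auto
  then show ?thesis
    by (simp add: power2_eq_square field_simps)
qed

lemma opt_discriminant: "(4 + 4 * i * p)\<^sup>2 - 4 * (3 * p) * (2 * i * (1 + p)) > 0"
  and opt_less: "opt i p < 3/5"
  using small_root_less[OF _ opt_quadratic_neg] ip by (auto simp: opt_def)

lemma opt_pos: "0 < opt i p"
  unfolding opt_def using ip by (intro small_root_greater) (auto intro: add_pos_pos)

lemma opt_root: "3 * p * (opt i p)\<^sup>2 - (4 + 4 * i * p) * opt i p + 2 * i * (1 + p) = 0"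
  using small_root_root[OF _ opt_discriminant] ip by (simp add: opt_def)

lemma opt_unique:
  assumes "x < 1" "3 * p * x\<^sup>2 - (4 + 4 * i * p) * x + 2 * i * (1 + p) = 0"
  shows "x = opt i p"
proof -
  have "p * x < 1/2"
    using assms(1) ip mult_strict_left_mono[of x 1 p] by linarith
  moreover have "0 < i * p"
    using ip by simp
  ultimately have "2 * (3 * p) * x < 4 + 4 * i * p"
    by simp
  then show ?thesis
    using assms ip small_root_unique[of "3 * p" x] by (simp add: opt_def)
qed

lemma mult_opt_less: "p * opt i p < 3/10"
  using mult_strict_mono[of p "1/2" "opt i p" "3/5"] ip opt_less opt_pos by simp

text \<open>For fixed \<open>u = p * opt i p\<close> the first-order condition is linear in i. This
  form eliminates i from all later slopes.\<close>

lemma opt_eq: "2 * (1 + p - 2 * (p * opt i p)) * i = opt i p * (4 - 3 * (p * opt i p))"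
  using opt_root by (simp add: power2_eq_square algebra_simps)

text \<open>At this level \<open>precision\<close> involves i only through
  \<open>opt i p / i\<close>, and \<open>opt_eq\<close> makes that ratio rational in p and
  \<open>p * opt i p\<close>.\<close>

lemma precision_opt:
  "precision i p (opt i p) * (4 - 3 * (p * opt i p)) =
     p * (4 - (2 * p + 3) * opt i p + p * (opt i p)\<^sup>2)"
proof -
  define y where "y = opt i p / i"
  have "y * (4 - 3 * (p * opt i p)) = 2 * (1 + p - 2 * (p * opt i p))"
    using opt_eq ip by (simp add: y_def field_simps)
  moreover have "precision i p (opt i p) = y * (2 - p * opt i p) - 1 + p * opt i p"
    by (simp add: precision_def y_def)
  ultimately show ?thesis
    by algebra
qed

lemma precision_opt_bounds: "0 < precision i p (opt i p)" "precision i p (opt i p) < 1"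
proof -
  define a where "a = opt i p"
  have a: "0 < a" "a < 3/5" "p * a < 3/10" "0 < p * a"
    using opt_pos opt_less mult_opt_less ip by (auto simp: a_def)
  let ?N = "4 - (2 * p + 3) * a + p * a\<^sup>2"
  have pa2: "0 < p * a\<^sup>2" "p * a\<^sup>2 < p * a"
    using a ip by (auto simp: power2_eq_square)
  have N: "0 < ?N" "?N < 4"
    using a pa2 by (auto simp: algebra_simps)
  have eq: "precision i p a * (4 - 3 * (p * a)) = p * ?N"
    using precision_opt by (simp add: a_def)
  have "0 < p * ?N"
    using N ip by simp
  then have "0 < precision i p a * (4 - 3 * (p * a))"
    using eq by simp
  then show "0 < precision i p (opt i p)"
    using a by (simp add: zero_less_mult_iff a_def)
  have "p * ?N < 1/2 * 4"
    using N ip by (intro mult_strict_mono) auto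
  then have "precision i p a * (4 - 3 * (p * a)) < 1 * (4 - 3 * (p * a))"
    using eq a by simp
  then show "precision i p (opt i p) < 1"
    using a unfolding a_def by (subst (asm) mult_less_cancel_right) auto
qed

section \<open>The level of equal loss in the two regimes\<close>

lemma match_quadratic:
  "p * x\<^sup>2 - (2 * p + 1) * x + 2 * (1 - min_loss i p) = 2 * (loss_J p x - min_loss i p)"
  by (simp add: loss_J_def power2_eq_square field_simps)

lemma min_loss_eq: "min_loss i p = loss_J p (opt i p) + opt i p * precision i p (opt i p) / 2"
  using loss_C_eq ip by (simp add: min_loss_def)

lemma match_quadratic_neg:
  "p * (opt i p)\<^sup>2 - (2 * p + 1) * opt i p + 2 * (1 - min_loss i p) < 0"
  unfolding match_quadratic using min_loss_eq opt_pos precision_opt_bounds by simp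

lemma match_discriminant: "(2 * p + 1)\<^sup>2 - 4 * p * (2 * (1 - min_loss i p)) > 0"
  and match_less: "match i p < opt i p"
  using small_root_less[OF _ match_quadratic_neg] ip by (auto simp: match_def)

lemma loss_match: "loss_J p (match i p) = min_loss i p"
proof -
  have "p * (match i p)\<^sup>2 - (2 * p + 1) * match i p + 2 * (1 - min_loss i p) = 0"
    unfolding match_def using small_root_root match_discriminant ip by blast
  then show ?thesis
    unfolding match_quadratic by simp
qed

text \<open>This is the source of \<open>d < 1/4\<close>: at three quarters of
  \<open>opt i p\<close> the loss of Regime J still exceeds \<open>min_loss\<close>. With
  \<open>a / 4\<close> factored out and the precision eliminated, a sum of positive terms
  remains.\<close>

lemma match_greater: "3/4 * opt i p < match i p"
proof -
  define a where "a = opt i p"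
  define u where "u = p * a"
  have a: "0 < a" "u < 3/10" "0 < u"
    using opt_pos opt_less mult_opt_less ip by (auto simp: a_def u_def)
  have "0 < (4 - 8 * p) + 2 * p * u + 2 * u + 5/4 * u\<^sup>2"
    using a ip by (intro add_pos_pos) auto
  also have "\<dots> = (2 * p + 1 - 7/4 * u) * (4 - 3 * u) - 4 * (4 * p - (2 * p + 3) * u + u * u)"
    by (simp add: power2_eq_square field_simps)
  also have "4 * p - (2 * p + 3) * u + u * u = precision i p a * (4 - 3 * u)"
    using precision_opt by (simp add: a_def u_def power2_eq_square algebra_simps)
  finally have "0 < (4 - 3 * u) * (2 * p + 1 - 7/4 * u - 4 * precision i p a)"
    by (simp add: algebra_simps)
  then have "0 < 2 * p + 1 - 7/4 * u - 4 * precision i p a"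
    using a by (simp add: zero_less_mult_iff)
  then have "0 < a / 4 * (2 * p + 1 - 7/4 * u - 4 * precision i p a)"
    using a by simp
  also have "\<dots> = 2 * (loss_J p (3/4 * a) - min_loss i p)"
    unfolding min_loss_eq a_def[symmetric] u_def
    by (simp add: loss_J_def power2_eq_square field_simps)
  finally have *: "0 < p * (3/4 * a)\<^sup>2 - (2 * p + 1) * (3/4 * a) + 2 * (1 - min_loss i p)"
    by (simp only: match_quadratic)
  have "2 * p * (3/4 * a) < 2 * p + 1"
    using a ip unfolding u_def by linarith
  then show ?thesis
    unfolding match_def a_def[symmetric] using * ip by (intro small_root_greater)
qed

lemma match_pos: "0 < match i p"
  using match_greater opt_pos by linarith

text \<open>A cubic minus its value at a critical point has a double zero there. The sign of the
  linear cofactor then gives minimality at the levels of interest.\<close>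

lemma loss_C_diff_opt:
  "loss_C i p x - min_loss i p =
     (x - opt i p)\<^sup>2 * (2 * i * p + 2 - 2 * (p * opt i p) - p * x) / (2 * i)"
proof -
  define a where "a = opt i p"
  have "2 * i * (loss_C i p x - loss_C i p a) =
     2 * i * ((1 - p * x) * (1 - x) - (1 - p * a) * (1 - a)) + (2 - p * x) * x\<^sup>2 - (2 - p * a) * a\<^sup>2"
    using ip by (simp add: loss_C_def field_simps)
  also have "\<dots> = (x - a)\<^sup>2 * (2 * i * p + 2 - 2 * (p * a) - p * x)
      - (x - a) * (3 * p * a\<^sup>2 - (4 + 4 * i * p) * a + 2 * i * (1 + p))"
    by (simp add: power2_eq_square algebra_simps)
  also have "\<dots> = (x - a)\<^sup>2 * (2 * i * p + 2 - 2 * (p * a) - p * x)"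
    using opt_root by (simp add: a_def)
  finally show ?thesis
    using ip by (simp add: min_loss_def a_def field_simps)
qed

text \<open>By minimality \<open>loss_C\<close> at \<open>match i p\<close> exceeds
  \<open>min_loss\<close>, which is \<open>loss_J\<close> there; by \<open>loss_C_eq\<close> the gap
  carries the sign of the precision. The upper bound is inherited from \<open>opt i p\<close> by
  monotonicity.\<close>

lemma precision_match_bounds: "0 < precision i p (match i p)" "precision i p (match i p) < 1"
proof -
  let ?a = "opt i p" and ?b = "match i p"
  have "p * ?b < p * ?a"
    using match_less ip by simp
  then have "0 < 2 * i * p + 2 - 2 * (p * ?a) - p * ?b"
    using ip mult_opt_less mult_pos_pos[of i p] by linarith
  then have "0 < (?b - ?a)\<^sup>2 * (2 * i * p + 2 - 2 * (p * ?a) - p * ?b) / (2 * i)"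
    using ip match_less by (intro divide_pos_pos mult_pos_pos) auto
  then have "0 < loss_C i p ?b - loss_J p ?b"
    using loss_C_diff_opt[of ?b] loss_match by simp
  then show "0 < precision i p ?b"
    using ip loss_C_eq[of i p ?b] match_pos by (simp add: zero_less_mult_iff)
  show "precision i p ?b < 1"
    using precision_less[of i p ?b ?a] ip match_pos match_less opt_less precision_opt_bounds
    by linarith
qed


subsection \<open>The thresholds as precisions\<close>

text \<open>The fixed-point equation is multiplied by \<open>2 - \<beta>\<close>, which is nonzero.
  The explicit coefficient 1 matches the pattern of \<open>small_root\<close>.\<close>

lemma quadratic_iff_best_response:
  assumes "0 \<le> q" "q \<le> 1" "\<beta> < 1"
  shows "\<beta> = p * crit_verif i q \<beta> \<longleftrightarrow> 1 * \<beta>\<^sup>2 - (2 + p * i) * \<beta> + p * i * (1 + q) = 0"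
proof -
  have "crit_verif i q \<beta> * (2 - \<beta>) = i * (q + 1 - \<beta>)"
    using assms by (simp add: crit_verif_def field_simps)
  then have "\<beta> * (2 - \<beta>) - p * crit_verif i q \<beta> * (2 - \<beta>) =
      - (1 * \<beta>\<^sup>2 - (2 + p * i) * \<beta> + p * i * (1 + q))"
    by algebra
  then have "(\<beta> - p * crit_verif i q \<beta>) * (2 - \<beta>) =
      - (1 * \<beta>\<^sup>2 - (2 + p * i) * \<beta> + p * i * (1 + q))"
    by (simp add: algebra_simps)
  moreover have "2 - \<beta> \<noteq> 0"
    using assms by simp
  ultimately show ?thesis
    by (metis (no_types, opaque_lifting) add.inverse_neutral eq_iff_diff_eq_0 minus_equation_iff mult_eq_0_iff)
qed

lemma beta_J:
  assumes "0 \<le> q" "q \<le> 1" "l = 2 * p"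
  shows "0 \<le> beta_J i l q" "beta_J i l q < 1"
    "beta_J i l q = p * crit_verif i q (beta_J i l q)"
proof -
  let ?B = "2 + p * i" and ?C = "p * i * (1 + q)"
  have pi: "0 < p * i" "p * i * q \<le> p * i" "p * i < 1"
    using ip assms mult_strict_mono[of p 1 i 1] by (auto simp: mult_left_le)
  \<comment> \<open>At 1 the quadratic equals \<open>p * i * q - 1\<close>, so 1 separates the roots
    and only the smaller one can be an effort level.\<close>
  have neg: "1 * 1\<^sup>2 - ?B * 1 + ?C < 0"
    using pi by (simp add: algebra_simps)
  define r where "r = small_root 1 ?B ?C"
  have "r < 1"
    unfolding r_def using small_root_less(2)[OF _ neg] by simp
  moreover have "0 < r"
    unfolding r_def using pi assms by (intro small_root_greater) auto
  moreover have "1 * r\<^sup>2 - ?B * r + ?C = 0"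
    unfolding r_def using small_root_less(1)[OF _ neg] by (intro small_root_root) auto
  ultimately have r: "0 \<le> r \<and> r < 1 \<and> r = p * crit_verif i q r"
    using assms quadratic_iff_best_response by auto
  have "beta_J i l q = r"
    unfolding beta_J_def
  proof (rule the_equality)
    show "0 \<le> r \<and> r < 1 \<and> r = l / 2 * crit_verif i q r"
      using r assms by simp
  next
    fix \<beta> assume "0 \<le> \<beta> \<and> \<beta> < 1 \<and> \<beta> = l / 2 * crit_verif i q \<beta>"
    then have "1 * \<beta>\<^sup>2 - ?B * \<beta> + ?C = 0" "2 * 1 * \<beta> < ?B"
      using assms pi quadratic_iff_best_response[of q \<beta>] by auto
    then show "\<beta> = r"
      unfolding r_def using small_root_unique by simp
  qed
  then show "0 \<le> beta_J i l q" "beta_J i l q < 1"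
    "beta_J i l q = p * crit_verif i q (beta_J i l q)"
    using r by auto
qed

lemma a_bar_J:
  assumes "0 \<le> q" "q \<le> 1" "l = 2 * p"
  shows "0 \<le> a_bar_J i l q" "a_bar_J i l q < 1" "beta_J i l q = p * a_bar_J i l q"
    "precision i p (a_bar_J i l q) = q"
proof -
  let ?\<beta> = "beta_J i l q" and ?a = "a_bar_J i l q"
  note \<beta> = beta_J[OF assms]
  show \<beta>_eq: "?\<beta> = p * ?a"
    using \<beta> by (simp add: a_bar_J_def)
  have "?a * (2 - ?\<beta>) = i * (q + 1 - ?\<beta>)"
    using \<beta> by (simp add: a_bar_J_def crit_verif_def field_simps)
  then have eq: "?a * (2 - p * ?a) = i * (q + 1 - p * ?a)"
    using \<beta>_eq by simp
  then show "precision i p ?a = q"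
    using ip by (simp add: precision_def)
  have "0 \<le> p * ?a"
    using \<beta> \<beta>_eq by simp
  then show "0 \<le> ?a"
    using ip by (simp add: zero_le_mult_iff)
  have "?a * (2 - ?\<beta>) \<le> i * (2 - ?\<beta>)"
    unfolding eq[folded \<beta>_eq] using ip assms by (intro mult_left_mono) auto
  then have "?a \<le> i"
    using \<beta> by simp
  then show "?a < 1"
    using ip by simp
qed

lemma a_C:
  assumes "l = 2 * p"
  shows "a_C i l = opt i p"
proof -
  have eq: "3 * l * a\<^sup>2 - (8 + 4 * i * l) * a + 2 * i * (l + 2) =
      2 * (3 * p * a\<^sup>2 - (4 + 4 * i * p) * a + 2 * i * (1 + p))" for a
    using assms by (simp add: algebra_simps)
  show ?thesis
    unfolding a_C_def eq
    using opt_pos opt_less opt_root opt_unique by (intro the_equality) auto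
qed

lemma threshold_cutoff:
  assumes "0 \<le> q" "q \<le> 1" "l = 2 * p" "0 \<le> x" "x < 1"
  shows "a_bar_J i l q < x \<longleftrightarrow> q < precision i p x"
    and "x < a_bar_J i l q \<longleftrightarrow> precision i p x < q"
  using a_bar_J[OF assms(1-3)] assms(4,5) ip precision_less
  by (metis less_asym less_linear)+

lemma q_ddagger_eq:
  assumes "l = 2 * p"
  shows "q_ddagger i l = precision i p (opt i p)"
proof -
  let ?t = "precision i p (opt i p)"
  have risk: "audit_risk_J I c L k q > audit_risk_C I c L k \<longleftrightarrow> q < ?t"
    if "I / c = i" "L / k = l" "q \<in> {0..1}" for I c L k q
  proof -
    let ?a = "a_bar_J i l q"
    have a: "0 \<le> ?a" "?a < 1" "beta_J i l q = p * ?a" "0 \<le> opt i p" "opt i p < 1"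
      using a_bar_J[of q l] that assms opt_pos opt_less by auto
    \<comment> \<open>Both regimes have effort p times the level, so both risks are values of one
      decreasing function.\<close>
    have less: "(1 - p * y) * (1 - y) < (1 - p * x) * (1 - x)" if "0 \<le> x" "x < y" "y < 1" for x y
    proof -
      have "p * y < p * 1"
        using that ip by (intro mult_strict_left_mono) auto
      moreover have "p * x < p * y"
        using that ip by simp
      ultimately have "p * y < 1" "p * x < 1"
        using ip by linarith+
      with \<open>p * x < p * y\<close> show ?thesis
        using that by (intro mult_strict_mono) auto
    qed
    have "audit_risk_J I c L k q > audit_risk_C I c L k \<longleftrightarrow>
        (1 - p * opt i p) * (1 - opt i p) < (1 - p * ?a) * (1 - ?a)"
      using that a a_C[OF assms] assms
      by (simp add: audit_risk_J_def audit_risk_C_def beta_C_def)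
    also have "\<dots> \<longleftrightarrow> ?a < opt i p"
      using less a by (metis less_asym less_linear)
    also have "\<dots> \<longleftrightarrow> q < ?t"
      using threshold_cutoff(1)[of q l "opt i p"] that assms a by auto
    finally show ?thesis .
  qed
  show ?thesis
    unfolding q_ddagger_def
  proof (rule the_equality)
    show "0 < ?t \<and> ?t < 1 \<and> (\<forall>X I c L k. admissible X I c L k \<and> I / c = i \<and> L / k = l \<longrightarrow>
        (\<forall>q\<in>{0..1}. audit_risk_J I c L k q > audit_risk_C I c L k \<longleftrightarrow> q < ?t))"
      using risk precision_opt_bounds by blast
  next
    fix t
    assume t: "0 < t \<and> t < 1 \<and> (\<forall>X I c L k. admissible X I c L k \<and> I / c = i \<and> L / k = l \<longrightarrow>
        (\<forall>q\<in>{0..1}. audit_risk_J I c L k q > audit_risk_C I c L k \<longleftrightarrow> q < t))"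
    \<comment> \<open>A concrete choice of primitives keeps the quantifier over them from being
      vacuous, which uniqueness requires. Testing at \<open>q = t\<close> and \<open>q = ?t\<close>
      then forces equality.\<close>
    have "admissible 4 i 1 l 1"
      using ip assms by (simp add: admissible_def)
    then have "q < t \<longleftrightarrow> q < ?t" if "q \<in> {0..1}" for q
      using t risk[of i 1 l 1 q] that by auto
    from this[of t] this[of ?t] show "t = ?t"
      using t precision_opt_bounds by auto
  qed
qed

lemma q_dagger_eq:
  assumes "l = 2 * p"
  shows "q_dagger i l = precision i p (match i p)"
proof -
  let ?t = "precision i p (match i p)"
  have payoff: "U_J X I c L k q > U_C X I c L k \<longleftrightarrow> q > ?t"
    if "0 < I" "I / c = i" "L / k = l" "q \<in> {0..1}" for X I c L k q
  proof -
    let ?a = "a_bar_J i l q"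
    have a: "0 \<le> ?a" "?a < 1" "beta_J i l q = p * ?a" "0 \<le> match i p" "match i p < 1"
      using a_bar_J[of q l] that assms match_pos match_less opt_less by auto
    have c: "c = I / i"
      using that ip by auto
    have "U_J X I c L k q = 1/2 * (X - I) - I / 2 * loss_J p ?a"
      using that a by (simp add: U_J_def loss_J_def)
    moreover have "U_C X I c L k = 1/2 * (X - I) - I / 2 * min_loss i p"
      unfolding U_C_def that beta_C_def a_C[OF assms] min_loss_def loss_C_def
      using that assms ip unfolding c by (simp add: field_simps)
    ultimately have "U_J X I c L k q > U_C X I c L k \<longleftrightarrow> loss_J p ?a < loss_J p (match i p)"
      using that loss_match by simp
    also have "\<dots> \<longleftrightarrow> match i p < ?a"
      using loss_J_less ip a by (metis less_asym less_linear)
    also have "\<dots> \<longleftrightarrow> ?t < q"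
      using threshold_cutoff(2)[of q l "match i p"] that assms a by auto
    finally show ?thesis .
  qed
  show ?thesis
    unfolding q_dagger_def
  proof (rule the_equality)
    show "0 < ?t \<and> ?t < 1 \<and> (\<forall>X I c L k. admissible X I c L k \<and> I / c = i \<and> L / k = l \<longrightarrow>
        (\<forall>q\<in>{0..1}. U_J X I c L k q > U_C X I c L k \<longleftrightarrow> q > ?t))"
      using payoff precision_match_bounds by (auto simp: admissible_def)
  next
    fix t
    assume t: "0 < t \<and> t < 1 \<and> (\<forall>X I c L k. admissible X I c L k \<and> I / c = i \<and> L / k = l \<longrightarrow>
        (\<forall>q\<in>{0..1}. U_J X I c L k q > U_C X I c L k \<longleftrightarrow> q > t))"
    have "admissible 4 i 1 l 1"
      using ip assms by (simp add: admissible_def)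
    then have "q > t \<longleftrightarrow> q > ?t" if "q \<in> {0..1}" for q
      using t payoff[of i 1 l 1 q 4] that ip by auto
    from this[of t] this[of ?t] show "t = ?t"
      using t precision_match_bounds by auto
  qed
qed


subsection \<open>Signs of the derivatives\<close>

text \<open>Dividing the equation of equal losses by \<open>opt i p\<close> gives
  \<open>d * (2 * p + 1 - u * (2 - d))\<close> as the precision at \<open>opt i p\<close>. Equating
  this with \<open>precision_opt\<close> yields a relation linear in p, the hypothesis of the
  polynomial inequalities.\<close>

lemma match_param:
  obtains d where "match i p = opt i p * (1 - d)" "0 < d" "d < 1/4"
    "p * (4 - 2 * (p * opt i p) - 8 * d + 6 * (p * opt i p) * d) =
     d * (1 - 2 * (p * opt i p) + p * opt i p * d) * (4 - 3 * (p * opt i p)) + p * opt i p * (3 - p * opt i p)"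
proof
  define a where "a = opt i p"
  define u where "u = p * a"
  define d where "d = 1 - match i p / a"
  have a: "0 < a"
    using opt_pos by (simp add: a_def)
  have b: "match i p = a * (1 - d)"
    using a by (simp add: d_def)
  show "match i p = opt i p * (1 - d)" "0 < d" "d < 1/4"
    using b match_less match_greater a by (auto simp: d_def a_def field_simps)
  have "loss_J p (a * (1 - d)) = loss_J p a + a * precision i p a / 2"
    using loss_match min_loss_eq b by (simp add: a_def)
  then have "a * (d * (2 * p + 1 - u * (2 - d))) = a * precision i p a"
    by (simp add: loss_J_def u_def power2_eq_square field_simps)
  then have "d * (2 * p + 1 - u * (2 - d)) = precision i p a"
    using a by simp
  moreover have "precision i p a * (4 - 3 * u) = 4 * p - (2 * p + 3) * u + u * u"
    using precision_opt by (simp add: a_def u_def power2_eq_square algebra_simps)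
  ultimately have "d * (2 * p + 1 - u * (2 - d)) * (4 - 3 * u) = 4 * p - (2 * p + 3) * u + u * u"
    by simp
  then have "p * (4 - 2 * u - 8 * d + 6 * u * d) =
     d * (1 - 2 * u + u * d) * (4 - 3 * u) + u * (3 - u)"
    by (simp add: algebra_simps)
  then show "p * (4 - 2 * (p * opt i p) - 8 * d + 6 * (p * opt i p) * d) =
     d * (1 - 2 * (p * opt i p) + p * opt i p * d) * (4 - 3 * (p * opt i p)) + p * opt i p * (3 - p * opt i p)"
    by (simp add: u_def a_def)
qed

lemma opt_less_incentive: "opt i p < i"
proof -
  let ?u = "p * opt i p"
  have "0 < opt i p * (2 - 2 * p + ?u)"
    using opt_pos ip by (intro mult_pos_pos add_pos_pos) auto
  then have "2 * (1 + p - 2 * ?u) * opt i p < 2 * (1 + p - 2 * ?u) * i"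
    unfolding opt_eq by (simp add: algebra_simps)
  then show ?thesis
    using mult_opt_less ip by (simp add: mult_less_cancel_left)
qed

lemma opt_slope_denominator_pos: "0 < 4 + 4 * i * p - 6 * p * opt i p"
proof -
  have "0 < i * p"
    using ip by simp
  then show ?thesis
    using mult_opt_less unfolding mult.assoc by linarith
qed

text \<open>The total derivative of \<open>precision i p (opt i p)\<close> in p. The response of
  \<open>opt\<close> is positive by completing a square, the direct effect by
  \<open>opt i p < i\<close>.\<close>

lemma audit_slope_opt:
  defines "a \<equiv> opt i p"
  shows "(3 * a\<^sup>2 - 4 * i * a + 2 * i) / (4 + 4 * i * p - 6 * p * a) * (2 * (1 - p * a) / i + p) + (a - a\<^sup>2 / i) > 0"
proof -
  have a: "0 < a" "a < i" "p * a < 3/10"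
    using opt_pos opt_less_incentive mult_opt_less by (auto simp: a_def)
  have "0 < 3 * (a - 2/3 * i)\<^sup>2 + 2 * i * (1 - 2/3 * i)"
    using ip by (intro add_nonneg_pos mult_pos_pos) auto
  then have "0 < 3 * a\<^sup>2 - 4 * i * a + 2 * i"
    by (simp add: power2_eq_square field_simps)
  then have "0 < (3 * a\<^sup>2 - 4 * i * a + 2 * i) / (4 + 4 * i * p - 6 * p * a) * (2 * (1 - p * a) / i + p)"
    using opt_slope_denominator_pos a ip unfolding a_def[symmetric]
    by (intro mult_pos_pos divide_pos_pos[of "_ - _ + _"] divide_pos_pos add_pos_pos[of _ p]) simp_all
  moreover have "0 < a - a\<^sup>2 / i"
    using a ip by (simp add: power2_eq_square field_simps)
  ultimately show ?thesis
    by linarith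
qed

text \<open>The total derivative in i. Its two effects have opposite signs; once
  \<open>opt_eq\<close> is inserted the leading terms cancel and the remainder is negative because
  \<open>a < i\<close>.\<close>

lemma verification_slope_opt:
  defines "a \<equiv> opt i p"
  shows "(2 * (1 + p) - 4 * p * a) / (4 + 4 * i * p - 6 * p * a) * (2 * (1 - p * a) / i + p) - a * (2 - p * a) / i\<^sup>2 < 0"
    (is "?S < 0")
proof -
  let ?den = "4 + 4 * i * p - 6 * p * a"
  have a: "0 < a" "a < i" "p * a < 3/10"
    using opt_pos opt_less_incentive mult_opt_less by (auto simp: a_def)
  have den: "0 < ?den"
    using opt_slope_denominator_pos by (simp add: a_def)
  have "C / ?den * (2 * (1 - p * a) / i + p) * (i\<^sup>2 * ?den) =
      (C * i) * (2 * (1 - p * a) + p * i)" for C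
    using clear_denominators[of ?den i C "2 * (1 - p * a)" p 1] den ip by (simp add: power2_eq_square)
  then have "?S * (i\<^sup>2 * ?den) =
      ((2 * (1 + p) - 4 * p * a) * i) * (2 * (1 - p * a) + p * i) - a * (2 - p * a) * ?den"
    using ip unfolding left_diff_distrib[of _ _ "i\<^sup>2 * ?den"] by simp
  also have "(2 * (1 + p) - 4 * p * a) * i = a * (4 - 3 * (p * a))"
    using opt_eq by (simp add: a_def algebra_simps)
  also have "a * (4 - 3 * (p * a)) * (2 * (1 - p * a) + p * i) - a * (2 - p * a) * ?den =
      - a * p * ((i - a) * (4 - p * a) + a * (2 - p * a))"
    by (simp add: algebra_simps)
  also have "\<dots> < 0"
    using a ip by (auto intro!: mult_pos_pos add_pos_pos simp: mult_less_0_iff)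
  finally show ?thesis
    using den ip by (auto simp: mult_less_0_iff)
qed

lemma match_slope_denominator_pos: "0 < 2 * p + 1 - 2 * p * match i p"
proof -
  have "p * match i p < p * 1"
    using match_less opt_less ip by (intro mult_strict_left_mono) auto
  then show ?thesis
    unfolding mult.assoc by linarith
qed

lemma verification_slope_match:
  defines "a \<equiv> opt i p" and "b \<equiv> match i p"
  shows "(2 - p * a) * a\<^sup>2 / i\<^sup>2 / (2 * p + 1 - 2 * p * b) * (2 * (1 - p * b) / i + p) - b * (2 - p * b) / i\<^sup>2 < 0"
    (is "?S < 0")
proof -
  obtain d where d: "b = a * (1 - d)" "0 < d" "d < 1/4"
    "p * (4 - 2 * (p * a) - 8 * d + 6 * (p * a) * d) =
     d * (1 - 2 * (p * a) + p * a * d) * (4 - 3 * (p * a)) + p * a * (3 - p * a)"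
    unfolding a_def b_def by (rule match_param)
  define u where "u = p * a"
  let ?K = "1 + p - 2 * u" and ?den = "2 * p + 1 - 2 * p * b"
  have a: "0 < a" "0 < u" "u < 3/10" "0 < ?K"
    using opt_pos mult_opt_less ip by (auto simp: a_def u_def)
  have den: "0 < ?den"
    using match_slope_denominator_pos by (simp add: b_def)
  have i: "2 * ?K * i = a * (4 - 3 * u)"
    using opt_eq by (simp add: a_def u_def)
  have w: "p * b = u * (1 - d)"
    by (simp add: d(1) u_def)
  \<comment> \<open>\<open>?T\<close> is minus the slope times \<open>i ^ 3 * ?den\<close>. A
    further factor \<open>2 * ?K\<close> eliminates i through \<open>opt_eq\<close> and leaves
    \<open>a\<^sup>2 * ?E\<close>.\<close>
  let ?T = "i * ?den * b * (2 - p * b) - (2 - u) * a\<^sup>2 * (2 * (1 - p * b) + p * i)"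
  let ?E = "(4 - 3 * u) * (2 * p + 1 - 2 * (u * (1 - d))) * (1 - d) * (2 - u * (1 - d))
       - (2 - u) * (4 * (1 - u * (1 - d)) * (1 + p - 2 * u) + u * (4 - 3 * u))"
  have "?E > 0"
    using a d(2-4) by (intro verification_polynomial_pos) (auto simp: u_def)
  have "2 * ?K * ?T = (2 * ?K * i) * ?den * b * (2 - p * b)
      - (2 - u) * a\<^sup>2 * (4 * ?K * (1 - p * b) + p * (2 * ?K * i))"
    by (simp add: algebra_simps)
  also have "\<dots> = a * (4 - 3 * u) * ?den * b * (2 - p * b)
      - (2 - u) * a\<^sup>2 * (4 * ?K * (1 - p * b) + u * (4 - 3 * u))"
    unfolding i by (simp add: u_def mult.assoc mult.left_commute)
  also have "\<dots> = a\<^sup>2 * ?E"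
    using w d(1) by algebra
  also have "\<dots> > 0"
    using \<open>?E > 0\<close> a by simp
  finally have "?T > 0"
    using a by (simp add: zero_less_mult_iff)
  moreover have "(2 - u) * a\<^sup>2 / i\<^sup>2 / ?den * (2 * (1 - p * b) / i + p) * (i ^ 3 * ?den) =
      (2 - u) * a\<^sup>2 * (2 * (1 - p * b) + p * i)"
    using clear_denominators[of ?den i "(2 - u) * a\<^sup>2 / i\<^sup>2" "2 * (1 - p * b)" p 2] den ip
    by (simp add: eval_nat_numeral)
  then have "?S * (i ^ 3 * ?den) = - ?T"
    using ip unfolding left_diff_distrib[of _ _ "i ^ 3 * ?den"] u_def
    by (simp add: power2_eq_square power3_eq_cube)
  ultimately have "?S * (i ^ 3 * ?den) < 0"
    by simp
  then show ?thesis
    using den ip by (auto simp: mult_less_0_iff)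
qed

lemma audit_slope_match:
  defines "a \<equiv> opt i p" and "b \<equiv> match i p"
  shows "(b\<^sup>2 - 2 * b + 2 * (a * (1 - a) + a ^ 3 / (2 * i))) / (2 * p + 1 - 2 * p * b) * (2 * (1 - p * b) / i + p) + (b - b\<^sup>2 / i) > 0"
    (is "?S > 0")
proof -
  obtain d where d: "b = a * (1 - d)" "0 < d" "d < 1/4"
    "p * (4 - 2 * (p * a) - 8 * d + 6 * (p * a) * d) =
     d * (1 - 2 * (p * a) + p * a * d) * (4 - 3 * (p * a)) + p * a * (3 - p * a)"
    unfolding a_def b_def by (rule match_param)
  define u where "u = p * a"
  let ?K = "1 + p - 2 * u" and ?den = "2 * p + 1 - 2 * p * b"
  let ?c = "b\<^sup>2 - 2 * b + 2 * (a * (1 - a) + a ^ 3 / (2 * i))"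
  have a: "0 < a" "0 < u" "u < 3/10" "0 < ?K"
    using opt_pos mult_opt_less ip by (auto simp: a_def u_def)
  have den: "0 < ?den"
    using match_slope_denominator_pos by (simp add: b_def)
  have i: "2 * ?K * i = a * (4 - 3 * u)"
    using opt_eq by (simp add: a_def u_def)
  let ?F = "2 * (4 * (1 - u * (1 - d)) * (1 + p - 2 * u) + u * (4 - 3 * u)) *
      ((4 - 3 * u) * (p * d - u + u * (1 - d)\<^sup>2 / 2) + u * (1 + p - 2 * u))
    + (4 - 3 * u) * u * (1 - d) * (4 - 3 * u - 2 * (1 - d) * (1 + p - 2 * u)) * (2 * p + 1 - 2 * (u * (1 - d)))"
  have "?F > 0"
    using a d(2-4) by (intro audit_polynomial_pos) (auto simp: u_def)
  \<comment> \<open>The factor \<open>4 - 3 * u\<close> removes i from \<open>?c\<close>; the factor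
    p added afterwards replaces p a by u.\<close>
  have "a / i * (4 - 3 * u) = 2 * ?K"
    using i ip by (simp add: field_simps)
  moreover have "a ^ 3 / (2 * i) = a\<^sup>2 / 2 * (a / i)"
    by (simp add: power2_eq_square power3_eq_cube)
  then have "a ^ 3 / (2 * i) * (4 - 3 * u) = a\<^sup>2 / 2 * (a / i * (4 - 3 * u))"
    by (simp add: power2_eq_square power3_eq_cube)
  ultimately have "a ^ 3 / (2 * i) * (4 - 3 * u) = a\<^sup>2 * ?K"
    by (simp only:)
  then have c: "p * (4 - 3 * u) * ?c =
      2 * a * ((4 - 3 * u) * (p * d - u + u * (1 - d)\<^sup>2 / 2) + u * ?K)"
    unfolding d(1) u_def by algebra
  let ?T = "?c * (2 * (1 - p * b) + p * i) + b * (i - b) * ?den"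
  \<comment> \<open>A free c stands for \<open>?c\<close>, so that the quotient inside it is not
    expanded.\<close>
  have "2 * ?K * (p * (4 - 3 * u)) * (c * (2 * (1 - p * b) + p * i) + b * (i - b) * ?den) =
      (p * (4 - 3 * u) * c) * (4 * ?K * (1 - p * b) + p * (2 * ?K * i))
      + (4 - 3 * u) * (p * b) * (2 * ?K * i - 2 * ?K * b) * ?den" for c
    by (simp add: algebra_simps)
  from this[of ?c] have "2 * ?K * (p * (4 - 3 * u)) * ?T =
      (p * (4 - 3 * u) * ?c) * (4 * ?K * (1 - p * b) + p * (2 * ?K * i))
      + (4 - 3 * u) * (p * b) * (2 * ?K * i - 2 * ?K * b) * ?den" .
  also have "\<dots> = a * ?F"
    unfolding c i unfolding d(1) u_def by (simp add: power2_eq_square field_simps)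
  also have "\<dots> > 0"
    using \<open>?F > 0\<close> a by simp
  finally have "2 * ?K * (p * (4 - 3 * u)) * ?T > 0" .
  moreover have "2 * ?K * (p * (4 - 3 * u)) > 0"
    using a ip by simp
  ultimately have "?T > 0"
    by (rule zero_less_mult_pos)
  have "C / ?den * (2 * (1 - p * b) / i + p) * (i * ?den) =
      C * (2 * (1 - p * b) + p * i)" for C
    using clear_denominators[of ?den i C "2 * (1 - p * b)" p 0] den ip by simp
  moreover have "(b - b\<^sup>2 / i) * (i * D) = b * (i - b) * D" for D
    using ip by (simp add: field_simps power2_eq_square)
  ultimately have "?S * (i * ?den) = ?T"
    by (simp only: distrib_right[of _ _ "i * ?den"])
  with \<open>?T > 0\<close> have "?S * (i * ?den) > 0"
    by (simp only:)
  moreover have "i * ?den > 0"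
    using den ip by simp
  ultimately show ?thesis
    by (rule zero_less_mult_pos2)
qed

end

subsection \<open>Differentiability of the critical levels\<close>

text \<open>Differentiating along a curve (f, g) treats both parameters at once; the partial
  derivatives are the cases of one constant coordinate.\<close>

lemma has_real_derivative_opt:
  assumes f: "(f has_real_derivative f') (at x)" and g: "(g has_real_derivative g') (at x)"
    and "0 < f x" "f x < 1" "0 < g x" "g x < 1/2" and a: "a = opt (f x) (g x)"
  shows "((\<lambda>x. opt (f x) (g x)) has_real_derivative
     (f' * (2 * (1 + g x) - 4 * g x * a) + g' * (3 * a\<^sup>2 - 4 * f x * a + 2 * f x)) /
     (4 + 4 * f x * g x - 6 * g x * a)) (at x)"
proof -
  have "((\<lambda>x. opt (f x) (g x)) has_real_derivative
     ((3 * g') * a\<^sup>2 - (4 * (f' * g x + f x * g')) * a + (2 * f' * (1 + g x) + 2 * f x * g')) /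
     (4 + 4 * f x * g x - 2 * (3 * g x) * a)) (at x)"
    unfolding opt_def
    using assms opt_discriminant[of "f x" "g x"]
    by (intro has_real_derivative_small_root)
      (auto simp: opt_def algebra_simps intro!: derivative_eq_intros)
  then show ?thesis
    by (rule DERIV_cong) (simp add: algebra_simps)
qed

text \<open>By the first-order condition, the variation of the optimal level does not contribute.\<close>

lemma has_real_derivative_min_loss:
  assumes f: "(f has_real_derivative f') (at x)" and g: "(g has_real_derivative g') (at x)"
    and ip: "0 < f x" "f x < 1" "0 < g x" "g x < 1/2" and a: "a = opt (f x) (g x)"
  shows "((\<lambda>x. min_loss (f x) (g x)) has_real_derivative
     - f' * ((2 - g x * a) * a\<^sup>2 / (2 * (f x)\<^sup>2)) - g' * (a * (1 - a) + a ^ 3 / (2 * f x))) (at x)"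
proof -
  obtain a' where a': "((\<lambda>x. opt (f x) (g x)) has_real_derivative a') (at x)"
    using has_real_derivative_opt[OF f g ip] by blast
  have "((\<lambda>x. min_loss (f x) (g x)) has_real_derivative
     - (g' * a + g x * a') * (1 - a) - (1 - g x * a) * a'
     + ((- (g' * a + g x * a') * a\<^sup>2 + (2 - g x * a) * (2 * a * a')) * (2 * f x)
        - (2 - g x * a) * a\<^sup>2 * (2 * f')) / (2 * f x)\<^sup>2) (at x)"
    unfolding min_loss_def loss_C_def
    using ip by (auto intro!: derivative_eq_intros a' f g simp: a power2_eq_square algebra_simps)
  moreover have "3 * g x * a\<^sup>2 - (4 + 4 * f x * g x) * a + 2 * f x * (1 + g x) = 0"
    using opt_root ip a by simp
  then have "- (g' * a + g x * a') * (1 - a) - (1 - g x * a) * a'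
     + ((- (g' * a + g x * a') * a\<^sup>2 + (2 - g x * a) * (2 * a * a')) * (2 * f x)
        - (2 - g x * a) * a\<^sup>2 * (2 * f')) / (2 * f x)\<^sup>2 =
     - f' * ((2 - g x * a) * a\<^sup>2 / (2 * (f x)\<^sup>2)) - g' * (a * (1 - a) + a ^ 3 / (2 * f x))"
    using ip by (simp add: divide_simps) algebra
  ultimately show ?thesis
    by simp
qed

lemma has_real_derivative_match:
  assumes f: "(f has_real_derivative f') (at x)" and g: "(g has_real_derivative g') (at x)"
    and ip: "0 < f x" "f x < 1" "0 < g x" "g x < 1/2"
    and a: "a = opt (f x) (g x)" and b: "b = match (f x) (g x)"
  shows "((\<lambda>x. match (f x) (g x)) has_real_derivative
     (f' * ((2 - g x * a) * a\<^sup>2 / (f x)\<^sup>2) +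
      g' * (b\<^sup>2 - 2 * b + 2 * (a * (1 - a) + a ^ 3 / (2 * f x)))) / (2 * g x + 1 - 2 * g x * b)) (at x)"
proof -
  let ?M' = "- f' * ((2 - g x * a) * a\<^sup>2 / (2 * (f x)\<^sup>2)) - g' * (a * (1 - a) + a ^ 3 / (2 * f x))"
  have "((\<lambda>x. match (f x) (g x)) has_real_derivative
     (g' * b\<^sup>2 - 2 * g' * b + - 2 * ?M') / (2 * g x + 1 - 2 * g x * b)) (at x)"
    unfolding match_def
    using ip match_discriminant[of "f x" "g x"]
    by (intro has_real_derivative_small_root)
      (auto simp: b match_def intro!: derivative_eq_intros f g has_real_derivative_min_loss[OF f g ip a])
  moreover have "g' * b\<^sup>2 - 2 * g' * b + - 2 * ?M' = f' * ((2 - g x * a) * a\<^sup>2 / (f x)\<^sup>2) +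
      g' * (b\<^sup>2 - 2 * b + 2 * (a * (1 - a) + a ^ 3 / (2 * f x)))"
    using ip by (simp add: field_simps)
  ultimately show ?thesis
    by (simp only:)
qed

lemma has_real_derivative_precision:
  assumes f: "(f has_real_derivative f') (at x)" and g: "(g has_real_derivative g') (at x)"
    and y: "(y has_real_derivative y') (at x)" and "f x \<noteq> 0"
  shows "((\<lambda>x. precision (f x) (g x) (y x)) has_real_derivative
     y' * (2 * (1 - g x * y x) / f x + g x) - f' * (y x * (2 - g x * y x) / (f x)\<^sup>2)
     + g' * (y x - (y x)\<^sup>2 / f x)) (at x)"
  unfolding precision_def
  by (rule derivative_eq_intros f g y assms refl)+ (use assms in \<open>simp add: field_simps power2_eq_square\<close>)

section \<open>Partial derivatives of the two thresholds\<close>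

theorem proposition6:
  fixes i l :: real
  assumes "0 < i" "i < 1" "0 < l" "l < 1"
  shows "(\<exists>D. ((\<lambda>x. q_dagger x l) has_real_derivative D) (at i) \<and> D < 0)
       \<and> (\<exists>D. ((\<lambda>y. q_dagger i y) has_real_derivative D) (at l) \<and> D > 0)
       \<and> (\<exists>D. ((\<lambda>x. q_ddagger x l) has_real_derivative D) (at i) \<and> D < 0)
       \<and> (\<exists>D. ((\<lambda>y. q_ddagger i y) has_real_derivative D) (at l) \<and> D > 0)"
proof -
  let ?p = "l / 2"
  have p: "0 < ?p" "?p < 1/2"
    using assms by auto
  note ip = assms(1,2) p
  \<comment> \<open>The closed forms of the thresholds hold only for parameters in (0,1); an open
    interval is enough to transfer a derivative.\<close>
  have local_i: "(F has_real_derivative D) (at i)"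
    if "(G has_real_derivative D) (at i)" "\<And>x. 0 < x \<Longrightarrow> x < 1 \<Longrightarrow> F x = G x" for F G :: "real \<Rightarrow> real" and D
    using that(1) by (rule has_field_derivative_transform_within_open[where S = "{0<..<1}"])
      (use assms that(2) in auto)
  have local_l: "(F has_real_derivative D) (at l)"
    if "(G has_real_derivative D) (at l)" "\<And>y. 0 < y \<Longrightarrow> y < 1 \<Longrightarrow> F y = G y" for F G :: "real \<Rightarrow> real" and D
    using that(1) by (rule has_field_derivative_transform_within_open[where S = "{0<..<1}"])
      (use assms that(2) in auto)
  \<comment> \<open>The closed forms use \<open>p = l / 2\<close>; the chain rule contributes 1/2,
    which preserves signs.\<close>
  have half: "((\<lambda>y. y / 2) has_real_derivative 1/2) (at l)"
    by (auto intro!: derivative_eq_intros)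
  note along_i = DERIV_ident[of "at i"] DERIV_const[where k = ?p and F = "at i"]
  note along_l = DERIV_const[where k = i and F = "at ?p"] DERIV_ident[of "at ?p"]
  note match_i = has_real_derivative_match[OF along_i ip refl refl]
  note match_l = has_real_derivative_match[OF along_l ip refl refl]
  note opt_i = has_real_derivative_opt[OF along_i ip refl]
  note opt_l = has_real_derivative_opt[OF along_l ip refl]
  have nz: "i \<noteq> 0"
    using assms by simp
  have "\<exists>D. ((\<lambda>x. q_dagger x l) has_real_derivative D) (at i) \<and> D < 0"
    by (rule exI, rule conjI, rule local_i[OF has_real_derivative_precision[OF along_i match_i nz]])
      (use p verification_slope_match[OF ip] in \<open>simp_all add: q_dagger_eq\<close>)
  moreover have "\<exists>D. ((\<lambda>y. q_dagger i y) has_real_derivative D) (at l) \<and> D > 0"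
    by (rule exI, rule conjI, rule local_l[OF DERIV_chain2[OF has_real_derivative_precision[OF along_l match_l nz] half]])
      (use assms audit_slope_match[OF ip] in \<open>simp_all add: q_dagger_eq\<close>)
  moreover have "\<exists>D. ((\<lambda>x. q_ddagger x l) has_real_derivative D) (at i) \<and> D < 0"
    by (rule exI, rule conjI, rule local_i[OF has_real_derivative_precision[OF along_i opt_i nz]])
      (use p verification_slope_opt[OF ip] in \<open>simp_all add: q_ddagger_eq\<close>)
  moreover have "\<exists>D. ((\<lambda>y. q_ddagger i y) has_real_derivative D) (at l) \<and> D > 0"
    by (rule exI, rule conjI, rule local_l[OF DERIV_chain2[OF has_real_derivative_precision[OF along_l opt_l nz] half]])
      (use assms audit_slope_opt[OF ip] in \<open>simp_all add: q_ddagger_eq\<close>)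
  ultimately show ?thesis
    by blast
qed

end
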